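(* Let $\Xi\subset\mathbb{R}^d$ be any full-dimensional polyhedron ($\dim\Xi=d$) having a vertex $\bm\zeta_0$ that is incident to more than $d$ edges of $\Xi$. Then there exist $\bm W$, $\bm H$ and $\bm b$ (of compatible dimensions $\bm W\in\mathbb{R}^{m\times r}$, $\bm H\in\mathbb{R}^{m\times d}$, $\bm b\in\mathbb{R}^m$) such that the recourse system $\bm W\bm y+\bm H\bm\xi\ge\bm b$ is globally feasible on $\Xi$ but not locally linear feasible at $\bm\zeta_0$.
   Context: Vector inequalities are componentwise. An edge of $\Xi$ is a one-dimensional face of $\Xi$ (possibly unbounded). The recourse system $\bm W\bm y+\bm H\bm\xi\ge\bm b$ has unknown $\bm y\in\mathbb{R}^r$ and parameter $\bm\xi\in\Xi$. Globally feasible on $\Xi$: there exists a function $\bm y:\mathbb{R}^d\to\mathbb{R}^r$ such that $\bm W\bm y(\bm\xi)+\bm H\bm\xi\ge\bm b$ for every $\bm\xi\in\Xi$. Locally linear feasible at a vertex $\bm\zeta_0$ of $\Xi$: there exist $\epsilon>0$ and an affine function $\bm y(\bm\xi)=\bm y_0+\bm Y\bm\xi$ with $\bm y_0\in\mathbb{R}^r$, $\bm Y\in\mathbb{R}^{r\times d}$, such that $\bm W\bm y(\bm\xi)+\bm H\bm\xi\ge\bm b$ for all $\bm\xi\in\Xi\cap B(\bm\zeta_0,\epsilon)$, where $B(\bm\zeta_0,\epsilon)$ is the ball of radius $\epsilon$ centered at $\bm\zeta_0$. *)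

theory Defs
  imports "HOL-Analysis.Analysis"
begin

text \<open>
  The numbers \<open>m\<close> of rows and \<open>r\<close> of recourse variables are existentially quantified in the
  theorem, hence they cannot be index types: a vector \<open>y\<close> of length \<open>r\<close> is a function on \<open>nat\<close> of
  which only the entries below \<open>r\<close> are used, \<open>W i j\<close> (\<open>i < m\<close>, \<open>j < r\<close>) are the entries of \<open>W\<close>, and
  the \<open>i\<close>-th row of \<open>H\<close> is the vector \<open>H i\<close>.
\<close>

definition recourse_system ::
  "nat \<Rightarrow> nat \<Rightarrow> (nat \<Rightarrow> nat \<Rightarrow> real) \<Rightarrow> (nat \<Rightarrow> real ^ 'd) \<Rightarrow> (nat \<Rightarrow> real)
    \<Rightarrow> (nat \<Rightarrow> real) \<Rightarrow> real ^ 'd::finite \<Rightarrow> bool"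
  where "recourse_system m r W H b y \<xi> \<longleftrightarrow>
    (\<forall>i<m. (\<Sum>j<r. W i j * y j) + (\<Sum>k\<in>UNIV. H i $ k * \<xi> $ k) \<ge> b i)"

definition globally_feasible ::
  "nat \<Rightarrow> nat \<Rightarrow> (nat \<Rightarrow> nat \<Rightarrow> real) \<Rightarrow> (nat \<Rightarrow> real ^ 'd) \<Rightarrow> (nat \<Rightarrow> real)
    \<Rightarrow> (real ^ 'd::finite) set \<Rightarrow> bool"
  where "globally_feasible m r W H b \<Xi> \<longleftrightarrow>
    (\<exists>y :: real ^ 'd \<Rightarrow> nat \<Rightarrow> real. \<forall>\<xi>\<in>\<Xi>. recourse_system m r W H b (y \<xi>) \<xi>)"

definition locally_linear_feasible ::
  "nat \<Rightarrow> nat \<Rightarrow> (nat \<Rightarrow> nat \<Rightarrow> real) \<Rightarrow> (nat \<Rightarrow> real ^ 'd) \<Rightarrow> (nat \<Rightarrow> real)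
    \<Rightarrow> (real ^ 'd::finite) set \<Rightarrow> real ^ 'd \<Rightarrow> bool"
  where "locally_linear_feasible m r W H b \<Xi> \<zeta>\<^sub>0 \<longleftrightarrow>
    (\<exists>\<epsilon>>0. \<exists>(y\<^sub>0 :: nat \<Rightarrow> real) (Y :: nat \<Rightarrow> real ^ 'd).
      \<forall>\<xi> \<in> \<Xi> \<inter> ball \<zeta>\<^sub>0 \<epsilon>.
        recourse_system m r W H b (\<lambda>j. y\<^sub>0 j + (\<Sum>k\<in>UNIV. Y j $ k * \<xi> $ k)) \<xi>)"

end

theory Submission
  imports Defs
begin

text \<open>
  Pick a point other than \<open>\<zeta>\<^sub>0\<close> on every edge \<open>e\<close> through \<open>\<zeta>\<^sub>0\<close> and let \<open>u e\<close> be its difference to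
  \<open>\<zeta>\<^sub>0\<close>. These are more than \<open>d\<close> distinct vectors, hence there is a nontrivial relation
  \<open>(\<Sum>e. c e *\<^sub>R u e) = 0\<close>. A single recourse variable suffices to turn it into an obstruction: a
  linear form that is nonpositive on every \<open>u e\<close> with \<open>c e \<ge> 0\<close>, and positive on every \<open>u e\<close> with
  \<open>c e < 0\<close>, contradicts the relation as soon as some coefficient is negative. The system has one
  row per edge, and the row of \<open>e\<close> imposes the required sign in the direction \<open>u e\<close>.

  The rows must still leave room for a nonlinear \<open>y\<close> on all of \<open>\<Xi>\<close>. Faces of a polyhedron are
  exposed, so there are linear forms \<open>p e\<close> and \<open>q\<close> that, evaluated at \<open>\<xi> - \<zeta>\<^sub>0\<close>, are nonnegative on
  \<open>\<Xi>\<close> and vanish exactly on \<open>e\<close> and exactly at \<open>\<zeta>\<^sub>0\<close> (\<open>face_supporting_functional\<close>). The rows are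
  \<open>y \<le> K * p e\<close> for \<open>c e \<ge> 0\<close> and \<open>y \<ge> q - K * p e\<close> for \<open>c e < 0\<close>; along \<open>e\<close> they read \<open>y \<le> 0\<close> and
  \<open>y \<ge> q\<close>. They are compatible at every point of \<open>\<Xi>\<close> if \<open>q \<le> K * (p e + p f)\<close> on \<open>\<Xi>\<close> for any two
  distinct edges. Such edges meet only in \<open>\<zeta>\<^sub>0\<close> (\<open>distinct_edges_meet_in_vertex\<close>), so \<open>p e + p f\<close>
  is positive away from \<open>\<zeta>\<^sub>0\<close>, and since a polyhedron is a cone near each of its points, a
  compactness argument on a small sphere provides \<open>K\<close> (\<open>linear_le_multiple_of_slack\<close>).

  Finally, \<open>q\<close> is positive on every \<open>u e\<close>, so the relation has coefficients of both signs
  (\<open>relation_has_negative_coefficient\<close>). Rows of both kinds therefore occur, which forces an affine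
  \<open>y\<close> to vanish at \<open>\<zeta>\<^sub>0\<close>; the constraints near \<open>\<zeta>\<^sub>0\<close> then become constraints on its linear part.
\<close>

section \<open>Polyhedra near a point\<close>

text \<open>
  A polyhedron agrees with its tangent cone in a ball around \<open>z\<close>: a half-space with \<open>z\<close> on its
  boundary is itself a cone with apex \<open>z\<close>, and one with \<open>z\<close> in its interior contains a ball around
  \<open>z\<close>. Factors \<open>t > 1\<close> are the ones that matter, since they allow moving a point of \<open>S\<close> outwards to
  a fixed sphere.
\<close>
lemma polyhedron_conic_near_point:
  fixes S :: "'a::euclidean_space set"
  assumes "polyhedron S" "z \<in> S"
  obtains \<delta> where "\<delta> > 0"
    "\<And>x t. \<lbrakk>x \<in> S; 0 \<le> t; t * norm (x - z) \<le> \<delta>\<rbrakk> \<Longrightarrow> z + t *\<^sub>R (x - z) \<in> S"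
proof -
  obtain F where F: "finite F" "S = \<Inter>F" "\<And>h. h \<in> F \<Longrightarrow> \<exists>a b. a \<noteq> 0 \<and> h = {x. a \<bullet> x \<le> b}"
    using assms(1) unfolding polyhedron_def by auto
  have "\<exists>\<delta>>0. \<forall>x\<in>h. \<forall>t\<ge>0. t * norm (x - z) \<le> \<delta> \<longrightarrow> z + t *\<^sub>R (x - z) \<in> h"
    if hF: "h \<in> F" for h
  proof -
    obtain a b where ab: "a \<noteq> 0" "h = {x. a \<bullet> x \<le> b}" using F(3)[OF hF] by blast
    have "a \<bullet> z \<le> b" using F(2) assms(2) ab(2) hF by auto
    then consider "a \<bullet> z = b" | "a \<bullet> z < b" by linarith
    then show ?thesis
    proof cases
      case 1
      have "a \<bullet> (z + t *\<^sub>R (x - z)) \<le> b" if "a \<bullet> x \<le> b" "0 \<le> t" for x t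
        using mult_left_mono[OF that] 1 by (simp add: inner_simps algebra_simps)
      then show ?thesis using ab(2) by (auto intro!: exI[of _ 1])
    next
      case 2
      have "a \<bullet> (z + t *\<^sub>R (x - z)) \<le> b"
        if "0 \<le> t" "t * norm (x - z) \<le> (b - a \<bullet> z) / norm a" for x t
      proof -
        have "a \<bullet> (t *\<^sub>R (x - z)) \<le> norm a * norm (t *\<^sub>R (x - z))"
          by (rule norm_cauchy_schwarz)
        also have "\<dots> = norm a * (t * norm (x - z))" using that(1) by simp
        also have "\<dots> \<le> b - a \<bullet> z"
          using that(2) ab(1) by (simp add: field_simps)
        finally show ?thesis by (simp add: inner_add_right)
      qed
      then show ?thesis using ab 2 by (intro exI[of _ "(b - a \<bullet> z) / norm a"]) simp
    qed
  qed
  then obtain d where d: "\<And>h. h \<in> F \<Longrightarrow> d h > 0"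
    "\<And>h x t. \<lbrakk>h \<in> F; x \<in> h; 0 \<le> t; t * norm (x - z) \<le> d h\<rbrakk> \<Longrightarrow> z + t *\<^sub>R (x - z) \<in> h"
    by metis
  define \<delta> where "\<delta> = Min (insert 1 (d ` F))"
  have "\<delta> > 0" "\<And>h. h \<in> F \<Longrightarrow> \<delta> \<le> d h"
    using F(1) d(1) by (auto simp: \<delta>_def)
  then show ?thesis using that[of \<delta>] d(2) F(2) by (meson Inter_iff order_trans)
qed

text \<open>
  Both sides are homogeneous in \<open>x - z\<close>, so only their quotient on a small sphere around \<open>z\<close> matters,
  where it is continuous on a compact set and hence bounded.
\<close>
lemma linear_le_multiple_of_slack:
  fixes S :: "'a::euclidean_space set"
  assumes "polyhedron S" "z \<in> S"
    and pos: "\<And>x. \<lbrakk>x \<in> S; x \<noteq> z\<rbrakk> \<Longrightarrow> p \<bullet> (x - z) > 0"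
  obtains K where "\<And>x. x \<in> S \<Longrightarrow> q \<bullet> (x - z) \<le> K * (p \<bullet> (x - z))"
proof -
  obtain \<delta> where \<delta>: "\<delta> > 0"
    "\<And>x t. \<lbrakk>x \<in> S; 0 \<le> t; t * norm (x - z) \<le> \<delta>\<rbrakk> \<Longrightarrow> z + t *\<^sub>R (x - z) \<in> S"
    using polyhedron_conic_near_point[OF assms(1,2)] by metis
  define C where "C = S \<inter> sphere z \<delta>"
  have C: "compact C" unfolding C_def
    using polyhedron_imp_closed[OF assms(1)] by (simp add: closed_Int_compact)
  have posC: "p \<bullet> (x - z) > 0" if "x \<in> C" for x
    using that pos \<delta>(1) by (auto simp: C_def)
  have "continuous_on C (\<lambda>x. (q \<bullet> (x - z)) / (p \<bullet> (x - z)))"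
    using posC by (intro continuous_intros) force
  from compact_continuous_image[OF this C]
  obtain K where K: "K > 0" "\<And>x. x \<in> C \<Longrightarrow> \<bar>(q \<bullet> (x - z)) / (p \<bullet> (x - z))\<bar> \<le> K"
    by (auto dest!: compact_imp_bounded simp: bounded_pos simp del: abs_divide)
  have "q \<bullet> (x - z) \<le> K * (p \<bullet> (x - z))" if x: "x \<in> S" for x
  proof (cases "x = z")
    case False
    define t where "t = \<delta> / norm (x - z)"
    have t: "t > 0" "t * norm (x - z) = \<delta>" using False \<delta>(1) by (auto simp: t_def)
    let ?w = "z + t *\<^sub>R (x - z)"
    have "?w \<in> C" using \<delta>(2)[OF x, of t] t \<delta>(1) by (simp add: C_def dist_norm)
    from K(2)[OF this] have "(q \<bullet> (x - z)) / (p \<bullet> (x - z)) \<le> K"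
      using t(1) by (simp del: abs_divide)
    then show ?thesis using pos[OF x False] by (simp add: field_simps)
  qed simp
  then show ?thesis using that by blast
qed

section \<open>Faces and edges\<close>

lemma face_supporting_functional:
  fixes S :: "'a::euclidean_space set"
  assumes "polyhedron S" "e face_of S" "z \<in> e"
  obtains p where "\<And>x. x \<in> S \<Longrightarrow> p \<bullet> (x - z) \<ge> 0"
    "\<And>x. x \<in> S \<Longrightarrow> p \<bullet> (x - z) = 0 \<longleftrightarrow> x \<in> e"
proof -
  have "e exposed_face_of S" using assms(1,2) by (simp add: exposed_face_of_polyhedron)
  then obtain a b where ab: "S \<subseteq> {x. a \<bullet> x \<le> b}" "e = S \<inter> {x. a \<bullet> x = b}"
    unfolding exposed_face_of_def by blast
  then have "a \<bullet> z = b" using assms(3) by auto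
  with ab show ?thesis by (intro that[of "- a"]) (auto simp: inner_diff_right)
qed

text \<open>
  The intersection is a proper face of one of the two edges, so its dimension is below one.
\<close>
lemma distinct_edges_meet_in_vertex:
  fixes S :: "'a::euclidean_space set"
  assumes "e edge_of S" "f edge_of S" "e \<noteq> f" "z \<in> e" "z \<in> f"
  shows "e \<inter> f = {z}"
proof -
  have f: "e face_of S" "f face_of S" and d: "aff_dim e = 1" "aff_dim f = 1"
    using assms(1,2) by (auto simp: edge_of_def)
  have sub: "g \<inter> h = g \<or> aff_dim (g \<inter> h) < 1"
    if "g face_of S" "h face_of S" "aff_dim g = 1" for g h
  proof -
    have "g \<inter> h face_of g"
      using that by (meson face_of_Int face_of_imp_subset face_of_subset inf_le1)
    then show ?thesis using face_of_aff_dim_lt[of g "g \<inter> h"] face_of_imp_convex that by metis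
  qed
  have "aff_dim (e \<inter> f) < 1"
    using sub[of e f] sub[of f e] f d assms(3) by (metis inf.commute)
  moreover have "\<not> aff_dim (e \<inter> f) < 0" using assms(4,5) by auto
  ultimately have "aff_dim (e \<inter> f) = 0" by linarith
  then obtain w where "e \<inter> f = {w}" unfolding aff_dim_eq_0 by blast
  moreover have "z \<in> e \<inter> f" using assms(4,5) by simp
  ultimately show ?thesis by simp
qed

section \<open>Recourse systems and linear relations\<close>

text \<open>
  Lets the rows of a system with one recourse variable be labelled by arbitrary objects, here edges,
  instead of natural numbers.
\<close>
lemma rows_indexed_by_finite_set:
  fixes h :: "'i \<Rightarrow> real ^ 'd::finite"
  assumes "finite I"
  obtains m W H b where
    "\<And>y \<xi>. recourse_system m 1 W H b y \<xi> \<longleftrightarrow> (\<forall>i\<in>I. w i * y 0 + h i \<bullet> \<xi> \<ge> \<beta> i)"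
proof -
  obtain g and n :: nat where I: "I = g ` {..<n}"
    using ex_bij_betw_nat_finite[OF assms] by (metis bij_betw_imp_surj_on lessThan_atLeast0)
  have "(\<forall>i<n. P (g i)) \<longleftrightarrow> (\<forall>i\<in>I. P i)" for P
    unfolding I by auto
  then show ?thesis
    by (intro that[of n "\<lambda>i j. w (g i)" "\<lambda>i. h (g i)" "\<lambda>i. \<beta> (g i)"])
      (simp add: recourse_system_def inner_vec_def)
qed

lemma linear_relation_of_many_vectors:
  fixes u :: "'i \<Rightarrow> 'a::euclidean_space"
  assumes "finite E" "card E > DIM('a)" "inj_on u E"
  obtains c where "\<exists>e\<in>E. c e \<noteq> 0" "(\<Sum>e\<in>E. c e *\<^sub>R u e) = 0"
proof -
  have "dependent (u ` E)"
    using assms by (intro dependent_biggerset) (simp add: card_image)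
  then obtain c where "\<exists>v\<in>u ` E. c v \<noteq> 0" "(\<Sum>v\<in>u ` E. c v *\<^sub>R v) = 0"
    using assms(1) by (auto simp: dependent_finite)
  then show ?thesis
    using that[of "c \<circ> u"] by (auto simp: sum.reindex[OF assms(3)])
qed

text \<open>
  Applying \<open>q\<close> to the relation would otherwise give a positive sum. Applied to \<open>- c\<close>, the same result
  yields a positive coefficient.
\<close>
lemma relation_has_negative_coefficient:
  fixes u :: "'i \<Rightarrow> 'a::real_inner"
  assumes "finite E" "\<exists>e\<in>E. c e \<noteq> 0" "(\<Sum>e\<in>E. c e *\<^sub>R u e) = 0"
    and pos: "\<And>e. e \<in> E \<Longrightarrow> q \<bullet> u e > 0"
  shows "\<exists>e\<in>E. c e < 0"
proof (rule ccontr)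
  assume "\<not> ?thesis"
  then have c: "\<And>e. e \<in> E \<Longrightarrow> 0 \<le> c e" by force
  obtain e where e: "e \<in> E" "c e \<noteq> 0" using assms(2) by blast
  have "0 < (\<Sum>e\<in>E. c e * (q \<bullet> u e))"
  proof (rule sum_pos2[OF assms(1) e(1)])
    show "0 < c e * (q \<bullet> u e)" using c[OF e(1)] e(2) pos[OF e(1)] by simp
    show "0 \<le> c f * (q \<bullet> u f)" if "f \<in> E" for f
      using c[OF that] pos[OF that] by simp
  qed
  also have "\<dots> = q \<bullet> (\<Sum>e\<in>E. c e *\<^sub>R u e)" by (simp add: inner_sum_right)
  finally show False using assms(3) by simp
qed

section \<open>Global feasibility without local linear feasibility\<close>

theorem theorem4:
  fixes \<Xi> :: "(real ^ 'd::finite) set" and \<zeta>\<^sub>0 :: "real ^ 'd"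
  assumes "polyhedron \<Xi>"
    and "aff_dim \<Xi> = int CARD('d)"
    and "{\<zeta>\<^sub>0} face_of \<Xi>"
    and "card {e. e edge_of \<Xi> \<and> \<zeta>\<^sub>0 \<in> e} > CARD('d)"
  shows "\<exists>(m::nat) (r::nat) (W :: nat \<Rightarrow> nat \<Rightarrow> real) (H :: nat \<Rightarrow> real ^ 'd) (b :: nat \<Rightarrow> real).
    globally_feasible m r W H b \<Xi> \<and> \<not> locally_linear_feasible m r W H b \<Xi> \<zeta>\<^sub>0"
proof -
  define E where "E = {e. e edge_of \<Xi> \<and> \<zeta>\<^sub>0 \<in> e}"
  have cardE: "card E > CARD('d)" using assms(4) by (simp add: E_def)
  then have finE: "finite E" using card.infinite by fastforce
  have edge: "e edge_of \<Xi>" "e face_of \<Xi>" "\<zeta>\<^sub>0 \<in> e" "e \<subseteq> \<Xi>" if "e \<in> E" for e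
    using that by (auto simp: E_def edge_of_def dest: face_of_imp_subset)
  have z: "\<zeta>\<^sub>0 \<in> \<Xi>" using face_of_imp_subset[OF assms(3)] by simp

  obtain q where q_ge: "\<And>x. x \<in> \<Xi> \<Longrightarrow> q \<bullet> (x - \<zeta>\<^sub>0) \<ge> 0"
    and q_0: "\<And>x. x \<in> \<Xi> \<Longrightarrow> q \<bullet> (x - \<zeta>\<^sub>0) = 0 \<longleftrightarrow> x \<in> {\<zeta>\<^sub>0}"
    using face_supporting_functional[OF assms(1,3)] by (metis singletonI)
  have "\<exists>p. (\<forall>x\<in>\<Xi>. p \<bullet> (x - \<zeta>\<^sub>0) \<ge> 0) \<and> (\<forall>x\<in>\<Xi>. p \<bullet> (x - \<zeta>\<^sub>0) = 0 \<longleftrightarrow> x \<in> e)"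
    if "e \<in> E" for e
    using face_supporting_functional[OF assms(1) edge(2,3)[OF that]] by metis
  then obtain p where p_ge: "\<And>e x. \<lbrakk>e \<in> E; x \<in> \<Xi>\<rbrakk> \<Longrightarrow> p e \<bullet> (x - \<zeta>\<^sub>0) \<ge> 0"
    and p_0: "\<And>e x. \<lbrakk>e \<in> E; x \<in> \<Xi>\<rbrakk> \<Longrightarrow> p e \<bullet> (x - \<zeta>\<^sub>0) = 0 \<longleftrightarrow> x \<in> e"
    by metis
  have "\<exists>v. v \<in> e \<and> v \<noteq> \<zeta>\<^sub>0" if "e \<in> E" for e
  proof (rule ccontr)
    assume "\<not> ?thesis"
    then have "e = {\<zeta>\<^sub>0}" using edge(3)[OF that] by blast
    then show False using edge(1)[OF that] by (simp add: edge_of_def)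
  qed
  then obtain v where v: "\<And>e. e \<in> E \<Longrightarrow> v e \<in> e" "\<And>e. e \<in> E \<Longrightarrow> v e \<noteq> \<zeta>\<^sub>0" by metis
  define u where "u e = v e - \<zeta>\<^sub>0" for e
  have meet: "e \<inter> f = {\<zeta>\<^sub>0}" if "e \<in> E" "f \<in> E" "e \<noteq> f" for e f
    using distinct_edges_meet_in_vertex edge(1,3) that by metis
  have "inj_on u E"
  proof (rule inj_onI)
    fix e f assume *: "e \<in> E" "f \<in> E" "u e = u f"
    then have "v e \<in> e \<inter> f" using v(1)[OF *(1)] v(1)[OF *(2)] by (simp add: u_def)
    then show "e = f" using meet[OF *(1,2)] v(2)[OF *(1)] by blast
  qed
  then obtain c where c: "\<exists>e\<in>E. c e \<noteq> 0" "(\<Sum>e\<in>E. c e *\<^sub>R u e) = 0"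
    using linear_relation_of_many_vectors[OF finE, of u] cardE by auto
  have vX: "v e \<in> \<Xi>" if "e \<in> E" for e using v(1) edge(4) that by blast
  have qu: "q \<bullet> u e > 0" if "e \<in> E" for e
    using q_ge[OF vX] q_0[OF vX] v(2) that by (force simp: u_def order_less_le)
  have pu: "p e \<bullet> u e = 0" if "e \<in> E" for e
    using p_0[OF that vX[OF that]] v(1)[OF that] by (simp add: u_def)
  obtain eN where eN: "eN \<in> E" "c eN < 0"
    using relation_has_negative_coefficient[OF finE c qu] by blast
  obtain eP where eP: "eP \<in> E" "c eP > 0"
    using relation_has_negative_coefficient[OF finE, of "\<lambda>e. - c e" u q] c qu
    by (auto simp: sum_negf)

  have "\<exists>K. \<forall>x\<in>\<Xi>. q \<bullet> (x - \<zeta>\<^sub>0) \<le> K * (p e \<bullet> (x - \<zeta>\<^sub>0) + p f \<bullet> (x - \<zeta>\<^sub>0))"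
    if "e \<in> E" "f \<in> E" "e \<noteq> f" for e f
  proof -
    have "(p e + p f) \<bullet> (x - \<zeta>\<^sub>0) > 0" if x: "x \<in> \<Xi>" "x \<noteq> \<zeta>\<^sub>0" for x
    proof -
      have "x \<notin> e \<inter> f" using meet \<open>e \<in> E\<close> \<open>f \<in> E\<close> \<open>e \<noteq> f\<close> x by auto
      then show ?thesis
        using p_ge[OF \<open>e \<in> E\<close> x(1)] p_ge[OF \<open>f \<in> E\<close> x(1)] p_0[OF \<open>e \<in> E\<close> x(1)] p_0[OF \<open>f \<in> E\<close> x(1)]
        by (auto simp: inner_add_left)
    qed
    then show ?thesis
      using linear_le_multiple_of_slack[OF assms(1) z, of "p e + p f" q]
      by (metis inner_add_left)
  qed
  then obtain k where k: "\<And>e f x. \<lbrakk>e \<in> E; f \<in> E; e \<noteq> f; x \<in> \<Xi>\<rbrakk> \<Longrightarrow>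
      q \<bullet> (x - \<zeta>\<^sub>0) \<le> k e f * (p e \<bullet> (x - \<zeta>\<^sub>0) + p f \<bullet> (x - \<zeta>\<^sub>0))"
    by metis
  \<comment> \<open>One constant has to serve all pairs of edges, as the row of an edge knows no second edge.\<close>
  define K where "K = Max ((\<lambda>(e, f). k e f) ` (E \<times> E))"
  have K: "q \<bullet> (x - \<zeta>\<^sub>0) \<le> K * (p e \<bullet> (x - \<zeta>\<^sub>0)) + K * (p f \<bullet> (x - \<zeta>\<^sub>0))"
    if "e \<in> E" "f \<in> E" "e \<noteq> f" "x \<in> \<Xi>" for e f x
  proof -
    have "k e f \<le> K" using finE that unfolding K_def by (intro Max_ge) auto
    then have "k e f * (p e \<bullet> (x - \<zeta>\<^sub>0) + p f \<bullet> (x - \<zeta>\<^sub>0)) \<le>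
        K * (p e \<bullet> (x - \<zeta>\<^sub>0) + p f \<bullet> (x - \<zeta>\<^sub>0))"
      using p_ge that by (intro mult_right_mono) auto
    then show ?thesis using k[OF that] by (simp add: distrib_left)
  qed

  \<comment> \<open>The right-hand sides \<open>h e \<bullet> \<zeta>\<^sub>0\<close> below make all rows homogeneous in \<open>\<xi> - \<zeta>\<^sub>0\<close> and \<open>y\<close>.\<close>
  define w where "w e = (if c e < 0 then 1 else - 1 :: real)" for e
  define h where "h e = K *\<^sub>R p e - (if c e < 0 then q else 0)" for e
  obtain m W H b where rows: "\<And>y \<xi>. recourse_system m 1 W H b y \<xi> \<longleftrightarrow>
      (\<forall>e\<in>E. w e * y 0 + h e \<bullet> \<xi> \<ge> h e \<bullet> \<zeta>\<^sub>0)"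
    using rows_indexed_by_finite_set[OF finE,
      where w = w and h = h and \<beta> = "\<lambda>e. h e \<bullet> \<zeta>\<^sub>0"] by metis
  have rows': "recourse_system m 1 W H b y \<xi> \<longleftrightarrow> (\<forall>e\<in>E. w e * y 0 + h e \<bullet> (\<xi> - \<zeta>\<^sub>0) \<ge> 0)" for y \<xi>
    unfolding rows by (simp add: inner_diff_right algebra_simps)

  have "globally_feasible m 1 W H b \<Xi>"
    unfolding globally_feasible_def
  proof (intro exI ballI)
    fix \<xi> assume \<xi>: "\<xi> \<in> \<Xi>"
    let ?N = "{e\<in>E. c e < 0}"
    let ?L = "(\<lambda>e. q \<bullet> (\<xi> - \<zeta>\<^sub>0) - K * (p e \<bullet> (\<xi> - \<zeta>\<^sub>0))) ` ?N"
    have L: "finite ?L" "?L \<noteq> {}" using finE eN by auto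
    \<comment> \<open>The largest lower bound on \<open>y\<close>, a convex piecewise linear function, satisfies all rows.\<close>
    show "recourse_system m 1 W H b ((\<lambda>\<xi> (j::nat).
        Max ((\<lambda>e. q \<bullet> (\<xi> - \<zeta>\<^sub>0) - K * (p e \<bullet> (\<xi> - \<zeta>\<^sub>0))) ` {e\<in>E. c e < 0})) \<xi>) \<xi>"
      unfolding rows'
    proof
      fix e assume e: "e \<in> E"
      show "0 \<le> w e * Max ?L + h e \<bullet> (\<xi> - \<zeta>\<^sub>0)"
      proof (cases "c e < 0")
        case True
        then have "q \<bullet> (\<xi> - \<zeta>\<^sub>0) - K * (p e \<bullet> (\<xi> - \<zeta>\<^sub>0)) \<le> Max ?L"
          using e L(1) by (intro Max_ge) auto
        with True show ?thesis by (simp add: w_def h_def inner_diff_left)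
      next
        case False
        have "Max ?L \<le> K * (p e \<bullet> (\<xi> - \<zeta>\<^sub>0))"
          using L K[OF _ e _ \<xi>] False by (subst Max_le_iff) (auto simp: algebra_simps)
        with False show ?thesis by (simp add: w_def h_def)
      qed
    qed
  qed
  moreover have "\<not> locally_linear_feasible m 1 W H b \<Xi> \<zeta>\<^sub>0"
  proof
    assume "locally_linear_feasible m 1 W H b \<Xi> \<zeta>\<^sub>0"
    then obtain \<epsilon> y\<^sub>0 Y where \<epsilon>: "\<epsilon> > 0" and feas: "\<And>\<xi>. \<xi> \<in> \<Xi> \<inter> ball \<zeta>\<^sub>0 \<epsilon> \<Longrightarrow>
        recourse_system m 1 W H b (\<lambda>j. y\<^sub>0 j + (\<Sum>k\<in>UNIV. Y j $ k * \<xi> $ k)) \<xi>"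
      unfolding locally_linear_feasible_def by blast
    have feas': "w e * (y\<^sub>0 0 + Y 0 \<bullet> \<xi>) + h e \<bullet> (\<xi> - \<zeta>\<^sub>0) \<ge> 0"
      if "e \<in> E" "\<xi> \<in> \<Xi> \<inter> ball \<zeta>\<^sub>0 \<epsilon>" for e \<xi>
      using feas[OF that(2)] that(1) unfolding rows' by (simp add: inner_vec_def)
    \<comment> \<open>At \<open>\<zeta>\<^sub>0\<close> the row of \<open>eN\<close> says \<open>y \<ge> 0\<close> and the row of \<open>eP\<close> says \<open>y \<le> 0\<close>.\<close>
    have y0: "y\<^sub>0 0 + Y 0 \<bullet> \<zeta>\<^sub>0 = 0"
      using feas'[OF eN(1), of \<zeta>\<^sub>0] feas'[OF eP(1), of \<zeta>\<^sub>0] eN eP z \<epsilon> by (simp add: w_def)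
    \<comment> \<open>Each edge has points close to \<open>\<zeta>\<^sub>0\<close>, so its row holds for the linear part in direction \<open>u e\<close>.\<close>
    have dir: "w e * (Y 0 \<bullet> u e) + h e \<bullet> u e \<ge> 0" if e: "e \<in> E" for e
    proof -
      define t where "t = min 1 (\<epsilon> / (2 * norm (u e)))"
      have ne: "norm (u e) > 0" using v(2)[OF e] by (simp add: u_def)
      have t: "t > 0" "t \<le> 1" using \<epsilon> ne by (auto simp: t_def)
      have "t * norm (u e) \<le> \<epsilon> / (2 * norm (u e)) * norm (u e)"
        using ne by (intro mult_right_mono) (auto simp: t_def)
      also have "\<dots> < \<epsilon>" using ne \<epsilon> by simp
      finally have "\<zeta>\<^sub>0 + t *\<^sub>R u e \<in> ball \<zeta>\<^sub>0 \<epsilon>" using t by (simp add: dist_norm)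
      moreover have "\<zeta>\<^sub>0 + t *\<^sub>R u e \<in> \<Xi>"
      proof -
        have "(1 - t) *\<^sub>R \<zeta>\<^sub>0 + t *\<^sub>R v e \<in> \<Xi>"
          using polyhedron_imp_convex[OF assms(1)] z vX[OF e] t by (simp add: convex_alt)
        then show ?thesis by (simp add: u_def algebra_simps)
      qed
      ultimately have "w e * (y\<^sub>0 0 + Y 0 \<bullet> \<zeta>\<^sub>0 + t * (Y 0 \<bullet> u e)) + t * (h e \<bullet> u e) \<ge> 0"
        using feas'[OF e, of "\<zeta>\<^sub>0 + t *\<^sub>R u e"] by (simp add: inner_add_right add.assoc)
      then have "t * (w e * (Y 0 \<bullet> u e) + h e \<bullet> u e) \<ge> 0"
        unfolding y0 by (simp add: algebra_simps)
      then show ?thesis using t(1) by (simp add: zero_le_mult_iff)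
    qed
    have neg: "c e * (Y 0 \<bullet> u e) < 0" if "e \<in> E" "c e < 0" for e
      using dir[OF that(1)] qu[OF that(1)] pu[OF that(1)] that(2)
      by (simp add: w_def h_def inner_diff_left mult_neg_pos)
    have nonpos: "c e * (Y 0 \<bullet> u e) \<le> 0" if "e \<in> E" for e
    proof (cases "c e < 0")
      case False
      then have "Y 0 \<bullet> u e \<le> 0" using dir[OF that] pu[OF that] by (simp add: w_def h_def)
      with False show ?thesis by (simp add: mult_nonneg_nonpos)
    qed (use neg[OF that] in simp)
    have "(\<Sum>e\<in>E. c e * (Y 0 \<bullet> u e)) < (\<Sum>e\<in>E. 0)"
      using finE nonpos neg[OF eN] eN(1) by (intro sum_strict_mono_ex1) auto
    moreover have "(\<Sum>e\<in>E. c e * (Y 0 \<bullet> u e)) = Y 0 \<bullet> (\<Sum>e\<in>E. c e *\<^sub>R u e)"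
      by (simp add: inner_sum_right)
    ultimately show False using c(2) by simp
  qed
  ultimately show ?thesis by blast
qed

end
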